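(* Let $K, M\in\mathbb{C}^{n\times n}$ be invertible, let $0\neq b\in\mathbb{C}^n$, let $\sigma\in\mathbb{C}$ be such that $K+\sigma M$ is invertible, and let $\tau_1,\dots,\tau_m\in\mathbb{C}$ be such that each $K+\tau_k M$ is invertible. Let $Z_m$, $\bar H_m$ and $V_{m+1}$ be computed by $m$ steps of the flexible Arnoldi algorithm (described in the context), with associated matrices $\bar H_m(\sigma;T_m)$ and $H_m(\sigma;T_m)$, and assume that $H_m(\sigma;T_m)$ is invertible. Define the flexible FOM quantities $$y_m^{\mathrm{fom}}(\sigma)=H_m(\sigma;T_m)^{-1}\beta e_1,\qquad r_m^{\mathrm{fom}}(\sigma)=V_{m+1}\left(\beta e_1-\bar H_m(\sigma;T_m)y_m^{\mathrm{fom}}(\sigma)\right),$$ and the flexible GMRES quantities $$y_m^{\mathrm{gmres}}(\sigma)=\arg\min_{y\in\mathbb{C}^m}\|\beta e_1-\bar H_m(\sigma;T_m)y\|_2,\qquad r_m^{\mathrm{gmres}}(\sigma)=V_{m+1}\left(\beta e_1-\bar H_m(\sigma;T_m)y_m^{\mathrm{gmres}}(\sigma)\right).$$ Let $\eta:=h_{m+1,m}(\sigma-\tau_m)$ and $\alpha:=\|\eta H_m^{-*}(\sigma;T_m)e_m\|_2$. Then $$\|r_m^{\mathrm{fom}}(\sigma)-r_m^{\mathrm{gmres}}(\sigma)\|_2\le\frac{\alpha(1+\alpha)}{1+\alpha^2}\,\|r_m^{\mathrm{fom}}(\sigma)\|_2 .$$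
   Context: Notation: $\|\cdot\|_2$ is the Euclidean norm, $^*$ is the conjugate transpose, $H^{-*}=(H^{-1})^*$, and $e_k$ is the $k$-th canonical basis vector of $\mathbb{C}^m$ or $\mathbb{C}^{m+1}$ as dimensions require. Flexible Arnoldi algorithm (modified Gram--Schmidt): set $\beta=\|b\|_2$, $v_1=b/\beta$, and initialize the $(m+1)\times m$ matrix $\bar H_m=(h_{i,k})$ to zero. For $k=1,\dots,m$: solve $(K+\tau_kM)z_k=v_k$; set $w_k:=Mz_k$; for $i=1,\dots,k$ set $h_{i,k}:=v_i^*w_k$ and replace $w_k$ by $w_k-h_{i,k}v_i$; then set $h_{k+1,k}:=\|w_k\|_2$, stop if $h_{k+1,k}=0$, and otherwise set $v_{k+1}:=w_k/h_{k+1,k}$. It is understood that the $m$ steps have been completed without stopping, so that $v_1,\dots,v_{m+1}$ are all defined (and orthonormal). Set $V_m=[v_1,\dots,v_m]$, $V_{m+1}=[v_1,\dots,v_{m+1}]$, $Z_m=[z_1,\dots,z_m]$, $T_m=\mathrm{diag}\{\tau_1,\dots,\tau_m\}$. Thus $MZ_m=V_{m+1}\bar H_m$ and $KZ_m+MZ_mT_m=V_m$. Let $H_m$ be the $m\times m$ matrix consisting of the first $m$ rows of $\bar H_m$. Define $$\bar H_m(\sigma;T_m)=\begin{bmatrix}I_m\\0\end{bmatrix}+\bar H_m(\sigma I_m-T_m)\in\mathbb{C}^{(m+1)\times m},\qquad H_m(\sigma;T_m)=I_m+H_m(\sigma I_m-T_m)\in\mathbb{C}^{m\times m}.$$ *)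

theory Defs
  imports
    "Jordan_Normal_Form.Gauss_Jordan_Elimination"
    "Jordan_Normal_Form.Schur_Decomposition"
    "HOL-Analysis.L2_Norm"
begin

definition norm2 :: "complex vec \<Rightarrow> real" where
  "norm2 v = L2_set (\<lambda>i. cmod (v $ i)) {..<dim_vec v}"

abbreviation mat_inv :: "complex mat \<Rightarrow> complex mat" where
  "mat_inv A \<equiv> the (mat_inverse A)"

(* Matrix and vector indices start at 0: v_(k+1), z_(k+1), tau_(k+1)
   and h_(i+1,k+1) of the usual notation are col V k, col Z k, tau k and Hb $$ (i, k). *)

(* The working vector of the modified Gram-Schmidt loop, started at w, after the components
   along v 0, ..., v (i - 1) have been removed one after the other. Note that w \<bullet>c u is
   linear in w and conjugate-linear in u, that is, u^* w. *)
primrec mgs :: "(nat \<Rightarrow> complex vec) \<Rightarrow> complex vec \<Rightarrow> nat \<Rightarrow> complex vec" where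
  "mgs v w 0 = w"
| "mgs v w (Suc i) = mgs v w i - (mgs v w i \<bullet>c v i) \<cdot>\<^sub>v v i"

(* V = V_(m+1), Z = Z_m and Hb (the (m+1) x m Hessenberg matrix) are the output of m steps
   of the algorithm, all of which were completed: no subdiagonal entry vanishes. *)
definition flexible_arnoldi ::
  "complex mat \<Rightarrow> complex mat \<Rightarrow> complex vec \<Rightarrow> (nat \<Rightarrow> complex) \<Rightarrow> nat \<Rightarrow>
   complex mat \<Rightarrow> complex mat \<Rightarrow> complex mat \<Rightarrow> bool" where
  "flexible_arnoldi K M b \<tau> m V Z Hb \<longleftrightarrow>
     V \<in> carrier_mat (dim_vec b) (m + 1) \<and>
     Z \<in> carrier_mat (dim_vec b) m \<and>
     Hb \<in> carrier_mat (m + 1) m \<and>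
     col V 0 = complex_of_real (1 / norm2 b) \<cdot>\<^sub>v b \<and>
     (\<forall>k<m.
        (K + \<tau> k \<cdot>\<^sub>m M) *\<^sub>v col Z k = col V k \<and>
        (let w = mgs (col V) (M *\<^sub>v col Z k) in
           (\<forall>i\<le>k. Hb $$ (i, k) = w i \<bullet>c col V i) \<and>
           Hb $$ (k + 1, k) = complex_of_real (norm2 (w (k + 1))) \<and>
           Hb $$ (k + 1, k) \<noteq> 0 \<and>
           col V (k + 1) = (1 / Hb $$ (k + 1, k)) \<cdot>\<^sub>v w (k + 1)) \<and>
        (\<forall>i. k + 1 < i \<and> i \<le> m \<longrightarrow> Hb $$ (i, k) = 0))"

definition Hbar_shifted :: "nat \<Rightarrow> complex mat \<Rightarrow> (nat \<Rightarrow> complex) \<Rightarrow> complex \<Rightarrow> complex mat" where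
  "Hbar_shifted m Hb \<tau> \<sigma> =
     (1\<^sub>m m @\<^sub>r 0\<^sub>m 1 m) + Hb * (\<sigma> \<cdot>\<^sub>m 1\<^sub>m m - mat_diag m \<tau>)"

definition H_shifted :: "nat \<Rightarrow> complex mat \<Rightarrow> (nat \<Rightarrow> complex) \<Rightarrow> complex \<Rightarrow> complex mat" where
  "H_shifted m Hb \<tau> \<sigma> =
     1\<^sub>m m + mat m m (\<lambda>(i, k). Hb $$ (i, k)) * (\<sigma> \<cdot>\<^sub>m 1\<^sub>m m - mat_diag m \<tau>)"

definition projected_residual ::
  "nat \<Rightarrow> complex vec \<Rightarrow> complex mat \<Rightarrow> (nat \<Rightarrow> complex) \<Rightarrow> complex \<Rightarrow> complex vec \<Rightarrow> complex vec" where
  "projected_residual m b Hb \<tau> \<sigma> y =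
     complex_of_real (norm2 b) \<cdot>\<^sub>v unit_vec (m + 1) 0 - Hbar_shifted m Hb \<tau> \<sigma> *\<^sub>v y"

definition y_fom :: "nat \<Rightarrow> complex vec \<Rightarrow> complex mat \<Rightarrow> (nat \<Rightarrow> complex) \<Rightarrow> complex \<Rightarrow> complex vec" where
  "y_fom m b Hb \<tau> \<sigma> =
     mat_inv (H_shifted m Hb \<tau> \<sigma>) *\<^sub>v (complex_of_real (norm2 b) \<cdot>\<^sub>v unit_vec m 0)"

definition y_gmres :: "nat \<Rightarrow> complex vec \<Rightarrow> complex mat \<Rightarrow> (nat \<Rightarrow> complex) \<Rightarrow> complex \<Rightarrow> complex vec" where
  "y_gmres m b Hb \<tau> \<sigma> =
     arg_min (\<lambda>y. norm2 (projected_residual m b Hb \<tau> \<sigma> y)) (\<lambda>y. y \<in> carrier_vec m)"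

definition r_fom ::
  "nat \<Rightarrow> complex vec \<Rightarrow> complex mat \<Rightarrow> complex mat \<Rightarrow> (nat \<Rightarrow> complex) \<Rightarrow> complex \<Rightarrow> complex vec" where
  "r_fom m b V Hb \<tau> \<sigma> = V *\<^sub>v projected_residual m b Hb \<tau> \<sigma> (y_fom m b Hb \<tau> \<sigma>)"

definition r_gmres ::
  "nat \<Rightarrow> complex vec \<Rightarrow> complex mat \<Rightarrow> complex mat \<Rightarrow> (nat \<Rightarrow> complex) \<Rightarrow> complex \<Rightarrow> complex vec" where
  "r_gmres m b V Hb \<tau> \<sigma> = V *\<^sub>v projected_residual m b Hb \<tau> \<sigma> (y_gmres m b Hb \<tau> \<sigma>)"

end

theory Submission
  imports Defs
begin

text \<open>
  Write \<open>H\<close> for the square shifted Hessenberg matrix. The bordered matrix \<open>Hbar\<close> has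
  \<open>H\<close> on top, and its last row is \<open>\<eta> e\<^sub>m\<^sup>T\<close>, because the unshifted last row vanishes except in its
  last entry. Since \<open>H\<close> is invertible, a trial vector \<open>y\<close> may be replaced by \<open>p = \<beta> e\<^sub>1 - H y\<close>, the
  upper part of its residual, which ranges over all of \<open>\<complex>\<^sup>m\<close>. The last entry of the residual
  is then affine in \<open>p\<close>: it equals \<open>u\<^sup>* p - \<rho>\<close> with \<open>u\<close> the conjugate of \<open>\<eta>\<close> times
  \<open>H\<^sup>-\<^sup>* e\<^sub>m\<close>, so that \<open>\<alpha>\<close> is the norm of \<open>u\<close>, and \<open>\<rho>\<close> is \<open>\<eta>\<close> times the last entry of the FOM
  coefficient vector (lemma \<open>projected_residual_eq_bordered\<close>).

  In this form FOM is the choice \<open>p = 0\<close>, with residual norm \<open>\<bar>\<rho>\<bar>\<close>, and GMRES minimizes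
  \<open>\<parallel>p\<parallel>\<^sup>2 + \<bar>u\<^sup>* p - \<rho>\<bar>\<^sup>2\<close>. Completing the square (lemma \<open>norm2_bordered_complete_square\<close>)
  writes this as \<open>\<bar>\<rho>\<bar>\<^sup>2 / (1 + \<alpha>\<^sup>2)\<close> plus the squared norm of the difference between the
  residual and the one at \<open>q = \<rho> u / (1 + \<alpha>\<^sup>2)\<close>. So \<open>q\<close> is the unique minimizer, and taking \<open>p = 0\<close>
  shows that the distance of the two residuals is exactly \<open>\<alpha> / sqrt (1 + \<alpha>\<^sup>2)\<close> times the FOM
  residual norm. The Arnoldi basis is orthonormal (lemma \<open>flexible_arnoldi_orthonormal\<close>), so
  multiplication by it preserves these norms. Finally \<open>sqrt (1 + \<alpha>\<^sup>2) \<le> 1 + \<alpha>\<close> turns the exact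
  factor into the stated bound, which is therefore an equality only for \<open>\<alpha> = 0\<close> or a vanishing
  FOM residual.
\<close>

section \<open>Norms and adjoints of complex vectors\<close>

lemma norm2_sq: "(norm2 v)\<^sup>2 = (\<Sum>i<dim_vec v. (cmod (v $ i))\<^sup>2)"
  by (simp add: norm2_def L2_set_def sum_nonneg)

lemma norm2_nonneg [simp]: "0 \<le> norm2 v"
  by (simp add: norm2_def)

lemma norm2_eq_0_iff: "v \<in> carrier_vec n \<Longrightarrow> norm2 v = 0 \<longleftrightarrow> v = 0\<^sub>v n"
  by (auto simp: norm2_def L2_set_eq_0_iff intro!: eq_vecI)

lemma norm2_smult: "norm2 (c \<cdot>\<^sub>v v) = cmod c * norm2 v"
  unfolding norm2_def L2_set_right_distrib[OF norm_ge_zero]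
  by (rule L2_set_cong) (auto simp: norm_mult)

lemma cscalar_prod_self: "v \<bullet>c v = complex_of_real ((norm2 v)\<^sup>2)"
  by (simp add: norm2_sq scalar_prod_def lessThan_atLeast0 complex_norm_square del: of_real_power)

lemma norm2_diff_sq:
  assumes "x \<in> carrier_vec n" "y \<in> carrier_vec n"
  shows "(norm2 (x - y))\<^sup>2 = (norm2 x)\<^sup>2 - 2 * Re (x \<bullet>c y) + (norm2 y)\<^sup>2"
proof -
  have "(cmod (a - b))\<^sup>2 = (cmod a)\<^sup>2 - 2 * Re (a * cnj b) + (cmod b)\<^sup>2" for a b
    by (simp only: cmod_power2) (simp add: power2_eq_square algebra_simps)
  then show ?thesis
    using assms
    by (simp add: norm2_sq scalar_prod_def lessThan_atLeast0 sum.distrib sum_subtractf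
        sum_distrib_left)
qed

lemma norm2_append_single_sq:
  "(norm2 (x @\<^sub>v vec 1 (\<lambda>_. t)))\<^sup>2 = (norm2 x)\<^sup>2 + (cmod t)\<^sup>2"
  by (simp add: norm2_sq)

lemma mat_adjoint_index:
  assumes "A \<in> carrier_mat nr nc" "i < nc" "j < nr"
  shows "mat_adjoint A $$ (i, j) = conjugate (A $$ (j, i))"
  using assms by (auto simp: mat_adjoint_def mat_of_rows_index)

lemma mat_adjoint_carrier:
  assumes "A \<in> carrier_mat nr nc"
  shows "mat_adjoint A \<in> carrier_mat nc nr"
  using assms by (intro carrier_matI) (auto simp: mat_adjoint_def)

lemma cscalar_prod_mat_adjoint:
  fixes A :: "complex mat"
  assumes A: "A \<in> carrier_mat nr nc" and x: "x \<in> carrier_vec nc" and y: "y \<in> carrier_vec nr"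
  shows "(A *\<^sub>v x) \<bullet>c y = x \<bullet>c (mat_adjoint A *\<^sub>v y)"
proof -
  have "(A *\<^sub>v x) \<bullet>c y = (\<Sum>i<nr. \<Sum>j<nc. A $$ (i, j) * x $ j * cnj (y $ i))"
    using assms by (simp add: scalar_prod_def lessThan_atLeast0 sum_distrib_right)
  also have "\<dots> = (\<Sum>j<nc. \<Sum>i<nr. A $$ (i, j) * x $ j * cnj (y $ i))"
    by (rule sum.swap)
  also have "\<dots> = x \<bullet>c (mat_adjoint A *\<^sub>v y)"
    using assms mat_adjoint_carrier[OF A]
    by (simp add: scalar_prod_def lessThan_atLeast0 sum_distrib_left mat_adjoint_index[OF A] mult_ac)
  finally show ?thesis .
qed

lemma norm2_mult_orthonormal_cols:
  assumes V: "V \<in> carrier_mat n k" and x: "x \<in> carrier_vec k"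
    and orth: "\<And>i j. i < k \<Longrightarrow> j < k \<Longrightarrow> col V i \<bullet>c col V j = (if i = j then 1 else 0)"
  shows "norm2 (V *\<^sub>v x) = norm2 x"
proof -
  note Va = mat_adjoint_carrier[OF V]
  have "mat_adjoint V * V = 1\<^sub>m k"
  proof (rule eq_matI)
    fix i j assume "i < dim_row (1\<^sub>m k)" "j < dim_col (1\<^sub>m k)"
    then have ij: "i < k" "j < k" by auto
    have "(mat_adjoint V * V) $$ (i, j) = (\<Sum>l<n. V $$ (l, j) * cnj (V $$ (l, i)))"
      using V Va ij by (simp add: scalar_prod_def lessThan_atLeast0 mat_adjoint_index[OF V] mult_ac)
    also have "\<dots> = col V j \<bullet>c col V i"
      using V ij by (simp add: scalar_prod_def lessThan_atLeast0)
    finally show "(mat_adjoint V * V) $$ (i, j) = 1\<^sub>m k $$ (i, j)"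
      using orth[of j i] ij by auto
  qed (use V Va in auto)
  then have "mat_adjoint V *\<^sub>v (V *\<^sub>v x) = x"
    using V Va x by (simp flip: assoc_mult_mat_vec)
  then have "(V *\<^sub>v x) \<bullet>c (V *\<^sub>v x) = x \<bullet>c x"
    using cscalar_prod_mat_adjoint[OF V x, of "V *\<^sub>v x"] V x by simp
  then show ?thesis
    by (simp only: cscalar_prod_self of_real_eq_iff power2_eq_iff_nonneg norm2_nonneg)
qed

lemma mat_inv_inverts:
  fixes A :: "complex mat"
  assumes "A \<in> carrier_mat n n" "invertible_mat A"
  shows "mat_inv A \<in> carrier_mat n n" "A * mat_inv A = 1\<^sub>m n" "mat_inv A * A = 1\<^sub>m n"
proof -
  obtain B where B: "A * B = 1\<^sub>m n" "B * A = 1\<^sub>m (dim_row B)"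
    using assms by (auto simp: invertible_mat_def inverts_mat_def)
  have "B \<in> carrier_mat n n"
    using arg_cong[OF B(1), of dim_col] arg_cong[OF B(2), of dim_col] assms(1)
    by (intro carrier_matI) auto
  with B assms(1) have "A \<in> Units (ring_mat TYPE(complex) n ())"
    by (auto simp: Units_def ring_mat_def)
  with mat_inverse(1)[OF assms(1)] obtain C where C: "mat_inverse A = Some C" by fastforce
  with mat_inverse(2)[OF assms(1) C]
  show "mat_inv A \<in> carrier_mat n n" "A * mat_inv A = 1\<^sub>m n" "mat_inv A * A = 1\<^sub>m n"
    by auto
qed

section \<open>Orthonormality of the Arnoldi basis\<close>

lemma mgs_carrier:
  assumes "\<And>i. i < l \<Longrightarrow> v i \<in> carrier_vec n" "w \<in> carrier_vec n"
  shows "mgs v w l \<in> carrier_vec n"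
  using assms by (induction l) auto

text \<open>
  Each pass subtracts a multiple of a vector orthogonal to all the earlier ones, so orthogonality
  already gained is kept. This is why the modified Gram--Schmidt coefficients, taken from the
  current working vector instead of the original one, do the same job as the classical ones.
\<close>

lemma mgs_orthogonal:
  assumes "\<And>i. i < l \<Longrightarrow> v i \<in> carrier_vec n" "w \<in> carrier_vec n"
    and "\<And>i j. i < l \<Longrightarrow> j < l \<Longrightarrow> v i \<bullet>c v j = (if i = j then 1 else 0)"
    and "j < l"
  shows "mgs v w l \<bullet>c v j = 0"
  using assms
proof (induction l)
  case (Suc l)
  have [simp]: "mgs v w l \<in> carrier_vec n" "v l \<in> carrier_vec n" "v j \<in> carrier_vec n"
    using Suc.prems by (auto intro!: mgs_carrier)
  note [simp] = carrier_vecD[of "v l" n] carrier_vecD[of "v j" n]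
  have "mgs v w (Suc l) \<bullet>c v j = mgs v w l \<bullet>c v j - (mgs v w l \<bullet>c v l) * (v l \<bullet>c v j)"
    by (simp add: minus_scalar_prod_distrib[of _ n])
  with Suc show ?case
    by (cases "j = l") auto
qed simp

lemma flexible_arnoldi_orthonormal:
  assumes arn: "flexible_arnoldi K M b \<tau> m V Z Hb"
    and M: "M \<in> carrier_mat n n" and b: "b \<in> carrier_vec n" "b \<noteq> 0\<^sub>v n"
    and "i \<le> m" "j \<le> m"
  shows "col V i \<bullet>c col V j = (if i = j then 1 else 0)"
proof -
  have V: "V \<in> carrier_mat n (m + 1)" and Z: "Z \<in> carrier_mat n m"
    using arn b by (auto simp: flexible_arnoldi_def)
  have unit: "((1 / complex_of_real (norm2 w)) \<cdot>\<^sub>v w) \<bullet>c ((1 / complex_of_real (norm2 w)) \<cdot>\<^sub>v w) = 1"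
    if "norm2 w \<noteq> 0" for w
    using that by (simp add: cscalar_prod_self norm2_smult norm_divide)
  have "\<forall>i\<le>k. \<forall>j\<le>k. col V i \<bullet>c col V j = (if i = j then 1 else 0)" if "k \<le> m" for k
    using that
  proof (induction k)
    case 0
    have "norm2 b \<noteq> 0" using b norm2_eq_0_iff by blast
    then show ?case using arn unit[of b] by (simp add: flexible_arnoldi_def)
  next
    case (Suc k)
    define w where "w = mgs (col V) (M *\<^sub>v col Z k) (k + 1)"
    have k: "k < m" using Suc by simp
    have step: "Hb $$ (k + 1, k) = complex_of_real (norm2 w)" "norm2 w \<noteq> 0"
        "col V (k + 1) = (1 / complex_of_real (norm2 w)) \<cdot>\<^sub>v w"
    proof -
      have h: "Hb $$ (k + 1, k) = complex_of_real (norm2 w)" "Hb $$ (k + 1, k) \<noteq> 0"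
          "col V (k + 1) = (1 / Hb $$ (k + 1, k)) \<cdot>\<^sub>v w"
        using arn k unfolding flexible_arnoldi_def Let_def w_def by blast+
      show "Hb $$ (k + 1, k) = complex_of_real (norm2 w)" by (rule h)
      show "norm2 w \<noteq> 0" using h(1,2) by (simp only: of_real_eq_0_iff) simp
      show "col V (k + 1) = (1 / complex_of_real (norm2 w)) \<cdot>\<^sub>v w" using h(3) unfolding h(1) .
    qed
    have col: "col V i \<in> carrier_vec n" for i using V by auto
    have w: "w \<in> carrier_vec n"
      unfolding w_def using M Z k col by (intro mgs_carrier) auto
    have 0: "w \<bullet>c col V j = 0" if "j \<le> k" for j
      unfolding w_def using M Z k col Suc that by (intro mgs_orthogonal[of _ _ n]) auto
    have l: "col V (Suc k) \<bullet>c col V j = 0" if "j \<le> k" for j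
      using 0[OF that] step(3) w col[of j] by (simp add: step(3))
    have r: "col V j \<bullet>c col V (Suc k) = 0" if "j \<le> k" for j
      using l[OF that] conjugate_conjugate_sprod[OF col[of j] col[of "Suc k"]] 
        conjugate_vec_sprod_comm[OF col[of "Suc k"] col[of j]]
      by (metis conjugate_zero)
    have "col V (Suc k) \<bullet>c col V (Suc k) = 1"
      using unit[OF step(2)] step(3) by simp
    then show ?case
      using Suc l r by (auto simp: le_Suc_eq)
  qed
  from this[of m] assms show ?thesis by auto
qed

section \<open>A least-squares problem with one extra row\<close>

text \<open>
  Up to sign, this is the residual at \<open>p\<close> of the least-squares problem whose matrix is the identity
  bordered below by the row \<open>u\<^sup>*\<close> and whose right-hand side is zero but for a last entry \<open>\<rho>\<close>.
  Taking \<open>\<rho> = 0\<close> gives the linear part of this affine map of \<open>p\<close>.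
\<close>

definition bordered :: "complex vec \<Rightarrow> complex \<Rightarrow> complex vec \<Rightarrow> complex vec" where
  "bordered u \<rho> p = p @\<^sub>v vec 1 (\<lambda>_. p \<bullet>c u - \<rho>)"

lemma norm2_bordered_sq: "(norm2 (bordered u \<rho> p))\<^sup>2 = (norm2 p)\<^sup>2 + (cmod (p \<bullet>c u - \<rho>))\<^sup>2"
  unfolding bordered_def norm2_append_single_sq ..

lemma bordered_diff:
  assumes [simp]: "u \<in> carrier_vec m" "p \<in> carrier_vec m" "q \<in> carrier_vec m"
  shows "bordered u \<rho> p - bordered u \<rho> q = bordered u 0 (p - q)"
  by (intro eq_vecI)
    (auto simp: bordered_def minus_scalar_prod_distrib[of _ m]
      carrier_vecD[OF assms(2)] carrier_vecD[OF assms(3)])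

text \<open>
  The vector \<open>q\<close> solves the normal equation \<open>q + (u\<^sup>* q - \<rho>) u = 0\<close>; hence the residual at \<open>q\<close> is
  orthogonal to the range of the linear part, and the identity is Pythagoras. The first summand is
  the squared residual norm at \<open>q\<close>.
\<close>

lemma norm2_bordered_complete_square:
  fixes \<rho> :: complex
  assumes u [simp]: "u \<in> carrier_vec m" and p [simp]: "p \<in> carrier_vec m"
  defines "q \<equiv> (\<rho> / complex_of_real (1 + (norm2 u)\<^sup>2)) \<cdot>\<^sub>v u"
  shows "(norm2 (bordered u \<rho> p))\<^sup>2 =
    (cmod \<rho>)\<^sup>2 / (1 + (norm2 u)\<^sup>2) + (norm2 (bordered u 0 (p - q)))\<^sup>2"
proof -
  define a where "a = (norm2 u)\<^sup>2"
  define t where "t = 1 / (1 + a)"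
  note dims [simp] = carrier_vecD[OF u] carrier_vecD[OF p]
  define \<gamma> where "\<gamma> = p \<bullet>c u"
  \<comment> \<open>The relation \<open>t * a = 1 - t\<close> removes all denominators, so that only a polynomial identity is left.\<close>
  have "1 + a > 0" unfolding a_def by (simp add: add_pos_nonneg)
  then have t: "t * a = 1 - t" by (simp add: t_def field_simps)
  have q: "q = (\<rho> * of_real t) \<cdot>\<^sub>v u"
    by (simp add: q_def t_def a_def)
  have pq: "p \<bullet>c q = of_real t * (cnj \<rho> * \<gamma>)"
    by (simp add: q conjugate_smult_vec \<gamma>_def mult_ac)
  have "(p - q) \<bullet>c u = \<gamma> - \<rho> * of_real (t * a)"
    by (simp add: q minus_scalar_prod_distrib[of _ m] cscalar_prod_self \<gamma>_def a_def)
  then have qu: "(p - q) \<bullet>c u = \<gamma> - \<rho> * of_real (1 - t)"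
    by (simp only: t)
  have "(norm2 q)\<^sup>2 = (cmod \<rho>)\<^sup>2 * (t * (t * a))"
    by (simp add: q norm2_smult norm_mult power2_eq_square a_def)
  then have nq: "(norm2 q)\<^sup>2 = (cmod \<rho>)\<^sup>2 * (t * (1 - t))"
    by (simp only: t)
  have pq2: "(norm2 (p - q))\<^sup>2 = (norm2 p)\<^sup>2 - 2 * t * Re (cnj \<rho> * \<gamma>) + (cmod \<rho>)\<^sup>2 * (t * (1 - t))"
    using norm2_diff_sq[OF p, of q] by (simp add: pq nq) (simp add: q algebra_simps)
  have "(cmod (\<gamma> - \<rho>))\<^sup>2 = (cmod \<rho>)\<^sup>2 * t - 2 * t * Re (cnj \<rho> * \<gamma>)
      + (cmod \<rho>)\<^sup>2 * (t * (1 - t)) + (cmod (\<gamma> - \<rho> * of_real (1 - t)))\<^sup>2"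
    unfolding cmod_power2 by (simp add: algebra_simps power2_eq_square)
  then have "(norm2 (bordered u \<rho> p))\<^sup>2 = (cmod \<rho>)\<^sup>2 * t + (norm2 (bordered u 0 (p - q)))\<^sup>2"
    unfolding norm2_bordered_sq pq2 qu \<gamma>_def[symmetric] diff_zero by linarith
  then show ?thesis
    by (simp add: t_def a_def)
qed

lemma norm2_bordered_min:
  fixes \<rho> :: complex
  assumes u: "u \<in> carrier_vec m" and p: "p \<in> carrier_vec m"
  defines "q \<equiv> (\<rho> / complex_of_real (1 + (norm2 u)\<^sup>2)) \<cdot>\<^sub>v u"
  shows "norm2 (bordered u \<rho> q) \<le> norm2 (bordered u \<rho> p)"
proof -
  have q: "q \<in> carrier_vec m" using u by (simp add: q_def)
  have "(norm2 (bordered u \<rho> q))\<^sup>2 = (cmod \<rho>)\<^sup>2 / (1 + (norm2 u)\<^sup>2)"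
    unfolding norm2_bordered_complete_square[OF u q, of \<rho>] q_def[symmetric]
    using q u norm2_eq_0_iff[of "0\<^sub>v m" m] by (simp add: norm2_bordered_sq)
  also have "\<dots> \<le> (norm2 (bordered u \<rho> p))\<^sup>2"
    by (simp add: norm2_bordered_complete_square[OF u p])
  finally show ?thesis by (simp add: power2_le_iff_abs_le)
qed

lemma argmin_bordered_unique:
  assumes u: "u \<in> carrier_vec m" and p: "p \<in> carrier_vec m"
    and min: "\<And>q. q \<in> carrier_vec m \<Longrightarrow> norm2 (bordered u \<rho> p) \<le> norm2 (bordered u \<rho> q)"
  shows "p = (\<rho> / complex_of_real (1 + (norm2 u)\<^sup>2)) \<cdot>\<^sub>v u"
proof -
  define q where "q = (\<rho> / complex_of_real (1 + (norm2 u)\<^sup>2)) \<cdot>\<^sub>v u"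
  have q [simp]: "q \<in> carrier_vec m" using u by (simp add: q_def)
  have z: "q - q = 0\<^sub>v m" by simp
  have "(norm2 (bordered u \<rho> p))\<^sup>2 \<le> (norm2 (bordered u \<rho> q))\<^sup>2"
    using min[OF q] by (intro power_mono) auto
  then have "(norm2 (bordered u 0 (p - q)))\<^sup>2 \<le> (norm2 (bordered u 0 (0\<^sub>v m)))\<^sup>2"
    unfolding norm2_bordered_complete_square[OF u p, of \<rho>]
      norm2_bordered_complete_square[OF u q, of \<rho>] q_def[symmetric] z by simp
  also have "\<dots> = 0"
    using u norm2_eq_0_iff[of "0\<^sub>v m" m] by (simp add: norm2_bordered_sq)
  finally have "(norm2 (p - q))\<^sup>2 \<le> 0"
    unfolding norm2_bordered_sq using zero_le_power2[of "cmod ((p - q) \<bullet>c u - 0)"] by linarith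
  then have "p - q = 0\<^sub>v m" using norm2_eq_0_iff[of "p - q" m] p q by auto
  then have "(p - q) $ i = 0" if "i < m" for i using that by simp
  then have "p = q"
    by (intro eq_vecI) (auto simp: carrier_vecD[OF p] carrier_vecD[OF q])
  then show ?thesis by (simp add: q_def)
qed

text \<open>
  At \<open>p = 0\<close> the residual has norm \<open>\<bar>\<rho>\<bar>\<close>, and completing the square there splits \<open>\<bar>\<rho>\<bar>\<^sup>2\<close> into
  the minimum and the squared distance from the minimal residual.
\<close>

lemma norm2_bordered_zero_diff_argmin:
  fixes \<rho> :: complex
  assumes u: "u \<in> carrier_vec m"
  defines "q \<equiv> (\<rho> / complex_of_real (1 + (norm2 u)\<^sup>2)) \<cdot>\<^sub>v u"
  shows "norm2 (bordered u \<rho> (0\<^sub>v m) - bordered u \<rho> q)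
    = norm2 u / sqrt (1 + (norm2 u)\<^sup>2) * norm2 (bordered u \<rho> (0\<^sub>v m))"
proof -
  define a where "a = (norm2 u)\<^sup>2"
  have s: "1 + a > 0" unfolding a_def by (simp add: add_pos_nonneg)
  have q: "q \<in> carrier_vec m" using u by (simp add: q_def)
  have fom: "(norm2 (bordered u \<rho> (0\<^sub>v m)))\<^sup>2 = (cmod \<rho>)\<^sup>2"
    using u norm2_eq_0_iff[of "0\<^sub>v m" m] by (simp add: norm2_bordered_sq)
  have "(norm2 (bordered u \<rho> (0\<^sub>v m) - bordered u \<rho> q))\<^sup>2 = (cmod \<rho>)\<^sup>2 - (cmod \<rho>)\<^sup>2 / (1 + a)"
    using norm2_bordered_complete_square[OF u, of "0\<^sub>v m" \<rho>] bordered_diff[OF u _ q, of "0\<^sub>v m" \<rho>]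
    by (simp add: fom q_def a_def)
  also have "\<dots> = (norm2 u / sqrt (1 + a) * norm2 (bordered u \<rho> (0\<^sub>v m)))\<^sup>2"
    using s by (simp add: power_mult_distrib power_divide fom field_simps flip: a_def)
  finally show ?thesis
    using s by (simp add: power2_eq_iff_nonneg a_def)
qed

section \<open>The projected residual\<close>

lemma shift_eq_mat_diag: "\<sigma> \<cdot>\<^sub>m 1\<^sub>m m - mat_diag m \<tau> = mat_diag m (\<lambda>k. \<sigma> - \<tau> k :: complex)"
  by (rule eq_matI) (auto simp: mat_diag_def)

lemma H_shifted_carrier: "H_shifted m Hb \<tau> \<sigma> \<in> carrier_mat m m"
  by (intro carrier_matI) (auto simp: H_shifted_def shift_eq_mat_diag mat_diag_def)

lemma Hbar_shifted_carrier:
  "Hb \<in> carrier_mat (m + 1) m \<Longrightarrow> Hbar_shifted m Hb \<tau> \<sigma> \<in> carrier_mat (m + 1) m"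
  by (intro carrier_matI) (auto simp: Hbar_shifted_def shift_eq_mat_diag mat_diag_def)

lemma H_shifted_index:
  "i < m \<Longrightarrow> k < m \<Longrightarrow>
    H_shifted m Hb \<tau> \<sigma> $$ (i, k) = (if i = k then 1 else 0) + Hb $$ (i, k) * (\<sigma> - \<tau> k)"
  by (simp add: H_shifted_def shift_eq_mat_diag mat_diag_mult_right[of _ m m])

lemma Hbar_shifted_index:
  assumes "Hb \<in> carrier_mat (m + 1) m" "i \<le> m" "k < m"
  shows "Hbar_shifted m Hb \<tau> \<sigma> $$ (i, k) = (if i = k then 1 else 0) + Hb $$ (i, k) * (\<sigma> - \<tau> k)"
  using assms
  by (auto simp: Hbar_shifted_def shift_eq_mat_diag mat_diag_mult_right[of _ "m + 1" m] append_rows_def)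

text \<open>
  The Hessenberg shape leaves room for only one nonzero entry in the last row of the bordered matrix, so the
  last residual entry depends on \<open>y\<close> only through its last entry.
\<close>

lemma projected_residual_eq_append:
  assumes m: "m \<ge> 1" and Hb: "Hb \<in> carrier_mat (m + 1) m"
    and hess: "\<And>k. k + 1 < m \<Longrightarrow> Hb $$ (m, k) = 0"
    and y: "y \<in> carrier_vec m"
  shows "projected_residual m b Hb \<tau> \<sigma> y =
    (complex_of_real (norm2 b) \<cdot>\<^sub>v unit_vec m 0 - H_shifted m Hb \<tau> \<sigma> *\<^sub>v y)
      @\<^sub>v vec 1 (\<lambda>_. - (Hb $$ (m, m - 1) * (\<sigma> - \<tau> (m - 1)) * y $ (m - 1)))"
    (is "?l = ?r")
proof (rule eq_vecI)
  note H = H_shifted_carrier[of m Hb \<tau> \<sigma>] and Hbar = Hbar_shifted_carrier[OF Hb, of \<tau> \<sigma>]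
  show "dim_vec ?l = dim_vec ?r" using H Hbar by (simp add: projected_residual_def)
  fix i assume "i < dim_vec ?r"
  then have i: "i \<le> m" using H by simp
  have row: "(Hbar_shifted m Hb \<tau> \<sigma> *\<^sub>v y) $ i
      = (\<Sum>k<m. ((if i = k then 1 else 0) + Hb $$ (i, k) * (\<sigma> - \<tau> k)) * y $ k)"
    using Hbar y i Hbar_shifted_index[OF Hb i] by (simp add: scalar_prod_def lessThan_atLeast0)
  show "?l $ i = ?r $ i"
  proof (cases "i = m")
    case True
    have "(\<Sum>k<m. ((if i = k then 1 else 0) + Hb $$ (i, k) * (\<sigma> - \<tau> k)) * y $ k)
        = (\<Sum>k\<in>{m - 1}. Hb $$ (m, k) * (\<sigma> - \<tau> k) * y $ k)"
      using m hess True by (intro sum.mono_neutral_cong_right) auto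
    then show ?thesis
      using True m H Hbar row by (simp add: projected_residual_def)
  next
    case False
    then have "(H_shifted m Hb \<tau> \<sigma> *\<^sub>v y) $ i = (Hbar_shifted m Hb \<tau> \<sigma> *\<^sub>v y) $ i"
      unfolding row using H y i
      by (simp add: scalar_prod_def lessThan_atLeast0 H_shifted_index)
    then show ?thesis
      using False i m H Hbar by (simp add: projected_residual_def)
  qed
qed

text \<open>
  Applying the inverse of the shifted matrix to the upper part \<open>p\<close> of the residual gives the
  difference of the FOM coefficients and \<open>y\<close>. Its last entry is therefore a linear functional of
  \<open>p\<close>, and moving the inverse to the other side of the inner product represents this functional by
  \<open>u\<close>. The conjugate on \<open>\<eta>\<close> compensates for the conjugate-linear second argument of the inner product.
\<close>

lemma projected_residual_eq_bordered:
  fixes \<eta> :: complex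
  assumes m: "m \<ge> 1" and Hb: "Hb \<in> carrier_mat (m + 1) m"
    and hess: "\<And>k. k + 1 < m \<Longrightarrow> Hb $$ (m, k) = 0"
    and inv: "invertible_mat (H_shifted m Hb \<tau> \<sigma>)"
    and y: "y \<in> carrier_vec m"
  defines "\<eta> \<equiv> Hb $$ (m, m - 1) * (\<sigma> - \<tau> (m - 1))"
    and "u \<equiv> cnj \<eta> \<cdot>\<^sub>v (mat_adjoint (mat_inv (H_shifted m Hb \<tau> \<sigma>)) *\<^sub>v unit_vec m (m - 1))"
  shows "projected_residual m b Hb \<tau> \<sigma> y =
    bordered u (\<eta> * y_fom m b Hb \<tau> \<sigma> $ (m - 1))
      (complex_of_real (norm2 b) \<cdot>\<^sub>v unit_vec m 0 - H_shifted m Hb \<tau> \<sigma> *\<^sub>v y)"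
proof -
  define H where "H = H_shifted m Hb \<tau> \<sigma>"
  define B where "B = mat_inv H"
  define p where "p = complex_of_real (norm2 b) \<cdot>\<^sub>v unit_vec m 0 - H *\<^sub>v y"
  have H: "H \<in> carrier_mat m m" by (simp add: H_def H_shifted_carrier)
  have B: "B \<in> carrier_mat m m" and BH: "B * H = 1\<^sub>m m"
    using mat_inv_inverts[OF H] inv by (simp_all add: B_def H_def)
  have p: "p \<in> carrier_vec m" using H y by (simp add: p_def)
  have yf: "y_fom m b Hb \<tau> \<sigma> \<in> carrier_vec m"
    using B by (simp add: y_fom_def B_def H_def)
  have Bp: "B *\<^sub>v p = y_fom m b Hb \<tau> \<sigma> - y"
    using B H y BH 
    by (simp add: p_def mult_minus_distrib_mat_vec[of _ m m] y_fom_def flip: assoc_mult_mat_vec H_def B_def)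
  have "p \<bullet>c u = \<eta> * (p \<bullet>c (mat_adjoint B *\<^sub>v unit_vec m (m - 1)))"
    using p mat_adjoint_carrier[OF B] by (simp add: u_def conjugate_smult_vec B_def H_def)
  also have "\<dots> = \<eta> * ((B *\<^sub>v p) \<bullet>c unit_vec m (m - 1))"
    using cscalar_prod_mat_adjoint[OF B p] by simp
  also have "(B *\<^sub>v p) \<bullet>c unit_vec m (m - 1) = (B *\<^sub>v p) $ (m - 1)"
  proof -
    have "conjugate (unit_vec m (m - 1)) = (unit_vec m (m - 1) :: complex vec)"
      by (rule eq_vecI) (auto simp: unit_vec_def)
    then show ?thesis using m B p by simp
  qed
  finally have "p \<bullet>c u = \<eta> * (y_fom m b Hb \<tau> \<sigma> $ (m - 1) - y $ (m - 1))"
    using Bp yf y m by simp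
  then have "p \<bullet>c u - \<eta> * y_fom m b Hb \<tau> \<sigma> $ (m - 1) = - (\<eta> * y $ (m - 1))"
    by (simp add: algebra_simps)
  moreover have "projected_residual m b Hb \<tau> \<sigma> y = p @\<^sub>v vec 1 (\<lambda>_. - (\<eta> * y $ (m - 1)))"
    unfolding p_def H_def \<eta>_def by (rule projected_residual_eq_append[OF m Hb hess y])
  ultimately show ?thesis
    by (simp only: bordered_def H_def[symmetric] p_def[symmetric])
qed

theorem proposition3:
  fixes n m :: nat
    and K M V Z Hb :: "complex mat"
    and b :: "complex vec"
    and \<sigma> \<eta> :: complex
    and \<tau> :: "nat \<Rightarrow> complex"
    and \<alpha> :: real
  assumes "m \<ge> 1"
    and "K \<in> carrier_mat n n" and "invertible_mat K"
    and "M \<in> carrier_mat n n" and "invertible_mat M"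
    and "b \<in> carrier_vec n" and "b \<noteq> 0\<^sub>v n"
    and "invertible_mat (K + \<sigma> \<cdot>\<^sub>m M)"
    and "\<And>k. k < m \<Longrightarrow> invertible_mat (K + \<tau> k \<cdot>\<^sub>m M)"
    and "flexible_arnoldi K M b \<tau> m V Z Hb"
    and "invertible_mat (H_shifted m Hb \<tau> \<sigma>)"
  defines "\<eta> \<equiv> Hb $$ (m, m - 1) * (\<sigma> - \<tau> (m - 1))"
    and "\<alpha> \<equiv> norm2 (\<eta> \<cdot>\<^sub>v (mat_adjoint (mat_inv (H_shifted m Hb \<tau> \<sigma>)) *\<^sub>v unit_vec m (m - 1)))"
  shows "norm2 (r_fom m b V Hb \<tau> \<sigma> - r_gmres m b V Hb \<tau> \<sigma>)
           \<le> \<alpha> * (1 + \<alpha>) / (1 + \<alpha>\<^sup>2) * norm2 (r_fom m b V Hb \<tau> \<sigma>)"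
proof -
  note m = assms(1) and inv = assms(11)
  define H where "H = H_shifted m Hb \<tau> \<sigma>"
  define c where "c = complex_of_real (norm2 b) \<cdot>\<^sub>v unit_vec m 0"
  define u where "u = cnj \<eta> \<cdot>\<^sub>v (mat_adjoint (mat_inv H) *\<^sub>v unit_vec m (m - 1))"
  define \<rho> where "\<rho> = \<eta> * y_fom m b Hb \<tau> \<sigma> $ (m - 1)"
  define res where "res = projected_residual m b Hb \<tau> \<sigma>"
  define q where "q = (\<rho> / complex_of_real (1 + (norm2 u)\<^sup>2)) \<cdot>\<^sub>v u"
  let ?yf = "y_fom m b Hb \<tau> \<sigma>" and ?yg = "y_gmres m b Hb \<tau> \<sigma>"
  have Hb: "Hb \<in> carrier_mat (m + 1) m" and V: "V \<in> carrier_mat n (m + 1)"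
    using assms(10) assms(6) by (auto simp: flexible_arnoldi_def)
  have hess: "Hb $$ (m, k) = 0" if "k + 1 < m" for k
    using assms(10) that by (simp add: flexible_arnoldi_def)
  have H: "H \<in> carrier_mat m m" by (simp add: H_def H_shifted_carrier)
  have Hinv: "mat_inv H \<in> carrier_mat m m" "H * mat_inv H = 1\<^sub>m m"
    using mat_inv_inverts[OF H] inv by (simp_all add: H_def)
  have c: "c \<in> carrier_vec m" by (simp add: c_def)
  have u: "u \<in> carrier_vec m" using mat_adjoint_carrier[OF Hinv(1)] by (simp add: u_def)
  have q: "q \<in> carrier_vec m" using u by (simp add: q_def)
  have \<alpha>: "\<alpha> = norm2 u" by (simp add: \<alpha>_def u_def H_def norm2_smult)
  have res: "res y = bordered u \<rho> (c - H *\<^sub>v y)" if "y \<in> carrier_vec m" for y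
    unfolding res_def u_def \<rho>_def c_def H_def \<eta>_def
    by (rule projected_residual_eq_bordered[OF m Hb hess inv that])
  have solve: "H *\<^sub>v (mat_inv H *\<^sub>v x) = x" if "x \<in> carrier_vec m" for x
    using H Hinv that by (simp flip: assoc_mult_mat_vec)
  \<comment> \<open>Invertibility makes every upper part attainable, so minimizing over \<open>y\<close> amounts to minimizing over \<open>p\<close>.\<close>
  have onto: "res (mat_inv H *\<^sub>v (c - p)) = bordered u \<rho> p" if "p \<in> carrier_vec m" for p
  proof -
    have "c - (c - p) = p" using c that by (intro eq_vecI) auto
    then show ?thesis using that c Hinv(1) by (simp add: res solve)
  qed
  have fom: "res ?yf = bordered u \<rho> (0\<^sub>v m)"
  proof -
    have "?yf = mat_inv H *\<^sub>v c" by (simp add: y_fom_def c_def H_def)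
    moreover have "?yf \<in> carrier_vec m" using calculation Hinv(1) c by simp
    ultimately show ?thesis using c by (simp add: res solve)
  qed
  have min: "norm2 (bordered u \<rho> q) \<le> norm2 (bordered u \<rho> p)" if "p \<in> carrier_vec m" for p
    using norm2_bordered_min[OF u that] by (simp add: q_def)
  \<comment> \<open>The choice of a minimizer is meaningful only once some minimizer is exhibited, here the
    preimage of \<open>q\<close>.\<close>
  have "?yg \<in> carrier_vec m \<and> (\<forall>y\<in>carrier_vec m. norm2 (res ?yg) \<le> norm2 (res y))"
    unfolding y_gmres_def res_def[symmetric]
  proof (rule arg_minI)
    show "mat_inv H *\<^sub>v (c - q) \<in> carrier_vec m" using Hinv(1) c q by simp
    show "\<not> norm2 (res y) < norm2 (res (mat_inv H *\<^sub>v (c - q)))" if "y \<in> carrier_vec m" for y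
      using min[of "c - H *\<^sub>v y"] H c that by (simp add: onto[OF q] res not_less)
  qed (auto simp: not_less)
  then have yg: "?yg \<in> carrier_vec m" and yg_min: "\<And>y. y \<in> carrier_vec m \<Longrightarrow> norm2 (res ?yg) \<le> norm2 (res y)"
    by auto
  have gmres: "res ?yg = bordered u \<rho> q"
  proof -
    have "c - H *\<^sub>v ?yg = q"
      unfolding q_def
    proof (rule argmin_bordered_unique[OF u])
      show "c - H *\<^sub>v ?yg \<in> carrier_vec m" using c H yg by simp
      show "norm2 (bordered u \<rho> (c - H *\<^sub>v ?yg)) \<le> norm2 (bordered u \<rho> p)"
        if "p \<in> carrier_vec m" for p
        using yg_min[of "mat_inv H *\<^sub>v (c - p)"] that c Hinv(1) by (simp add: onto flip: res[OF yg])
    qed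
    then show ?thesis by (simp add: res[OF yg])
  qed
  have bc: "bordered u \<rho> p \<in> carrier_vec (m + 1)" if "p \<in> carrier_vec m" for p
    using that unfolding bordered_def by (intro append_carrier_vec) auto
  have iso: "norm2 (V *\<^sub>v x) = norm2 x" if "x \<in> carrier_vec (m + 1)" for x
    using norm2_mult_orthonormal_cols[OF V that]
      flexible_arnoldi_orthonormal[OF assms(10) assms(4) assms(6) assms(7)] by simp
  have f: "r_fom m b V Hb \<tau> \<sigma> = V *\<^sub>v bordered u \<rho> (0\<^sub>v m)"
    and g: "r_gmres m b V Hb \<tau> \<sigma> = V *\<^sub>v bordered u \<rho> q"
    by (simp_all add: r_fom_def r_gmres_def fom gmres flip: res_def)
  have "norm2 (r_fom m b V Hb \<tau> \<sigma> - r_gmres m b V Hb \<tau> \<sigma>)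
      = norm2 (bordered u \<rho> (0\<^sub>v m) - bordered u \<rho> q)"
    unfolding f g using V bc[OF q] bc[of "0\<^sub>v m"]
    by (simp flip: mult_minus_distrib_mat_vec[OF V] add: iso)
  also have "\<dots> = \<alpha> / sqrt (1 + \<alpha>\<^sup>2) * norm2 (r_fom m b V Hb \<tau> \<sigma>)"
    unfolding q_def norm2_bordered_zero_diff_argmin[OF u] by (simp add: f iso[OF bc[OF zero_carrier_vec]] \<alpha>)
  also have "\<dots> \<le> \<alpha> * (1 + \<alpha>) / (1 + \<alpha>\<^sup>2) * norm2 (r_fom m b V Hb \<tau> \<sigma>)"
  proof (rule mult_right_mono)
    have a: "\<alpha> \<ge> 0" by (simp add: \<alpha>)
    have s: "1 + \<alpha>\<^sup>2 > 0" by (simp add: add_pos_nonneg)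
    have "sqrt (1 + \<alpha>\<^sup>2) \<le> 1 + \<alpha>"
      using a by (intro real_le_lsqrt) (auto simp: power2_eq_square algebra_simps)
    then have "\<alpha> * sqrt (1 + \<alpha>\<^sup>2) / (1 + \<alpha>\<^sup>2) \<le> \<alpha> * (1 + \<alpha>) / (1 + \<alpha>\<^sup>2)"
      using a s by (intro divide_right_mono mult_left_mono) auto
    moreover have "\<alpha> / sqrt (1 + \<alpha>\<^sup>2) = \<alpha> * sqrt (1 + \<alpha>\<^sup>2) / (1 + \<alpha>\<^sup>2)"
      using s by (simp add: real_div_sqrt field_simps)
    ultimately show "\<alpha> / sqrt (1 + \<alpha>\<^sup>2) \<le> \<alpha> * (1 + \<alpha>) / (1 + \<alpha>\<^sup>2)" by simp
  qed simp
  finally show ?thesis .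
qed

end
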